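(* Let $n\ge1$, let $b_1,b_2,b_3\in\Delta_n$ be three distinct positive basis words, $T=\{b_1,b_2,b_3\}$ and $\Theta(T)=b_1+b_2+b_3\in\mathbb H^{\otimes n}$. Then $$\Theta(T)^2\in\mathbb R e_n\quad\Longleftrightarrow\quad b_1b_2=-b_2b_1,\quad b_1b_3=-b_3b_1,\quad b_2b_3=-b_3b_2 .$$ If in addition $T\in E_n$, then there is a common sign $$\varepsilon(T)=(-1)^{\nu(b_1)}=(-1)^{\nu(b_2)}=(-1)^{\nu(b_3)},$$ and $$T\in\mathrm{AC}_n\quad\Longleftrightarrow\quad \Theta(T)^2=3\,\varepsilon(T)\,e_n .$$
   Context: $\Delta_n=\{i,j,k,e\}^n$ is the set of words $b=b_1b_2\cdots b_n$ of length $n$ in the four symbols $i,j,k,e$. It is regarded as the (positive) basis of the real algebra $\mathbb H^{\otimes n}$ ($n$-fold tensor power over $\mathbb R$ of the quaternions), where words multiply coordinatewise as quaternions ($e$ the identity, $i^2=j^2=k^2=-e$, $ij=k$, $jk=i$, $ki=j$, distinct elements of $\{i,j,k\}$ anticommute), with local signs collected into one global sign; the identity is $e_n=ee\cdots e$. For $b\in\Delta_n$, $\nu(b)=\#\{r: b_r\ne e\}$. Put $v(i)=(\cos 210^\circ,\sin 210^\circ)$, $v(j)=(\cos 90^\circ,\sin 90^\circ)$, $v(k)=(\cos 330^\circ,\sin 330^\circ)$, $v(e)=(0,0)$ in $\mathbb R^2$. Fix a real $d_1>0$ and put $d_r=d_1/2^{r-1}$. The centroid map $P:\Delta_n\to\mathbb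 R^2$ is $$P(b)=\sum_{r=1}^n \sigma_r(b)\,d_r\,v(b_r),\qquad \sigma_r(b)=(-1)^{\#\{s<r:\ b_s=e\}}.$$ $E_n$ is the set of unordered triples $\{b_1,b_2,b_3\}$ of distinct words in $\Delta_n$ such that $P(b_1),P(b_2),P(b_3)$ are the vertices of a nondegenerate equilateral triangle. $\mathrm{AC}_n$ is the set of $T=\{b_1,b_2,b_3\}\in E_n$ with $b_1b_2=-b_2b_1$, $b_1b_3=-b_3b_1$, $b_2b_3=-b_3b_2$. *)

theory Defs
  imports "HOL-Analysis.Analysis" "HOL-Library.Poly_Mapping"
begin

datatype qsym = QI | QJ | QK | QE

type_synonym qword = "qsym list"

definition Delta :: "nat \<Rightarrow> qword set" where
  "Delta n = {b. length b = n}"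

abbreviation e_word :: "nat \<Rightarrow> qword" where
  "e_word n \<equiv> replicate n QE"

definition nu :: "qword \<Rightarrow> nat" where
  "nu b = card {r. r < length b \<and> b ! r \<noteq> QE}"

text \<open>The multiplication table of the quaternions: a product of two units is a sign times a unit.\<close>

fun qmul :: "qsym \<Rightarrow> qsym \<Rightarrow> real \<times> qsym" where
  "qmul QE y = (1, y)"
| "qmul x QE = (1, x)"
| "qmul QI QI = (-1, QE)"
| "qmul QJ QJ = (-1, QE)"
| "qmul QK QK = (-1, QE)"
| "qmul QI QJ = (1, QK)"
| "qmul QJ QK = (1, QI)"
| "qmul QK QI = (1, QJ)"
| "qmul QJ QI = (-1, QK)"
| "qmul QK QJ = (-1, QI)"
| "qmul QI QK = (-1, QJ)"

definition word_sign :: "qword \<Rightarrow> qword \<Rightarrow> real" where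
  "word_sign a b = prod_list (map2 (\<lambda>x y. fst (qmul x y)) a b)"

definition word_mul :: "qword \<Rightarrow> qword \<Rightarrow> qword" where
  "word_mul a b = map2 (\<lambda>x y. snd (qmul x y)) a b"

text \<open>
  The elements of the \<open>n\<close>-fold tensor power are the formal real linear combinations of the words
  of length \<open>n\<close>; \<open>Poly_Mapping.single b c\<close> is the multiple \<open>c b\<close> of the basis word \<open>b\<close>. Addition
  and negation are those of the type of finitely supported functions. The multiplication is the
  bilinear extension of the signed coordinatewise multiplication of words. It does not mention
  \<open>n\<close>, but is meaningful only for two arguments in the same \<open>quat_tensor n\<close>.
\<close>

type_synonym qtensor = "qword \<Rightarrow>\<^sub>0 real"

definition quat_tensor :: "nat \<Rightarrow> qtensor set" where
  "quat_tensor n = {x. Poly_Mapping.keys x \<subseteq> Delta n}"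

abbreviation basis_word :: "qword \<Rightarrow> qtensor" where
  "basis_word b \<equiv> Poly_Mapping.single b 1"

definition tmul :: "qtensor \<Rightarrow> qtensor \<Rightarrow> qtensor" (infixl \<open>\<odot>\<close> 70) where
  "x \<odot> y = (\<Sum>a\<in>Poly_Mapping.keys x. \<Sum>b\<in>Poly_Mapping.keys y.
     Poly_Mapping.single (word_mul a b)
       (word_sign a b * Poly_Mapping.lookup x a * Poly_Mapping.lookup y b))"

definition anticommute :: "qword \<Rightarrow> qword \<Rightarrow> bool" where
  "anticommute a b \<longleftrightarrow> basis_word a \<odot> basis_word b = - (basis_word b \<odot> basis_word a)"

definition Theta :: "qword set \<Rightarrow> qtensor" where
  "Theta T = (\<Sum>b\<in>T. basis_word b)"

text \<open>The multiplication is bilinear, associative and unital on \<open>quat_tensor n\<close>.\<close>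

lemma tmul_superset:
  assumes "finite A" "Poly_Mapping.keys x \<subseteq> A" "finite B" "Poly_Mapping.keys y \<subseteq> B"
  shows "x \<odot> y = (\<Sum>a\<in>A. \<Sum>b\<in>B.
     Poly_Mapping.single (word_mul a b)
       (word_sign a b * Poly_Mapping.lookup x a * Poly_Mapping.lookup y b))"
proof -
  have "x \<odot> y = (\<Sum>a\<in>Poly_Mapping.keys x. \<Sum>b\<in>B.
     Poly_Mapping.single (word_mul a b)
       (word_sign a b * Poly_Mapping.lookup x a * Poly_Mapping.lookup y b))"
    unfolding tmul_def
    by (intro sum.cong refl sum.mono_neutral_left) (use assms in \<open>auto simp: in_keys_iff\<close>)
  also have "\<dots> = (\<Sum>a\<in>A. \<Sum>b\<in>B.
     Poly_Mapping.single (word_mul a b)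
       (word_sign a b * Poly_Mapping.lookup x a * Poly_Mapping.lookup y b))"
    by (intro sum.mono_neutral_left) (use assms in \<open>auto simp: in_keys_iff intro!: sum.neutral\<close>)
  finally show ?thesis .
qed

lemma tmul_single:
  "Poly_Mapping.single a c \<odot> Poly_Mapping.single b d
     = Poly_Mapping.single (word_mul a b) (word_sign a b * c * d)"
  by (subst tmul_superset[of "{a}" _ "{b}"]) auto

lemma tmul_add_left: "(x + y) \<odot> z = x \<odot> z + y \<odot> z"
proof -
  let ?K = "Poly_Mapping.keys x \<union> Poly_Mapping.keys y" and ?L = "Poly_Mapping.keys z"
  have k: "finite ?K" "finite ?L" "Poly_Mapping.keys (x + y) \<subseteq> ?K"
    "Poly_Mapping.keys x \<subseteq> ?K" "Poly_Mapping.keys y \<subseteq> ?K" "?L \<subseteq> ?L"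
    using Poly_Mapping.keys_add[of x y] by auto
  show ?thesis
    unfolding tmul_superset[OF k(1,3,2,6)] tmul_superset[OF k(1,4,2,6)] tmul_superset[OF k(1,5,2,6)]
    by (simp add: lookup_add ring_distribs single_add sum.distrib)
qed

lemma tmul_add_right: "z \<odot> (x + y) = z \<odot> x + z \<odot> y"
proof -
  let ?K = "Poly_Mapping.keys x \<union> Poly_Mapping.keys y" and ?L = "Poly_Mapping.keys z"
  have k: "finite ?K" "finite ?L" "Poly_Mapping.keys (x + y) \<subseteq> ?K"
    "Poly_Mapping.keys x \<subseteq> ?K" "Poly_Mapping.keys y \<subseteq> ?K" "?L \<subseteq> ?L"
    using Poly_Mapping.keys_add[of x y] by auto
  show ?thesis
    unfolding tmul_superset[OF k(2,6,1,3)] tmul_superset[OF k(2,6,1,4)] tmul_superset[OF k(2,6,1,5)]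
    by (simp add: lookup_add ring_distribs single_add sum.distrib)
qed

lemma tmul_zero: "0 \<odot> x = 0" "x \<odot> 0 = 0"
  by (simp_all add: tmul_def)

lemma tmul_sum_left: "sum f A \<odot> z = (\<Sum>a\<in>A. f a \<odot> z)"
  by (induction A rule: infinite_finite_induct) (auto simp: tmul_add_left tmul_zero)

lemma tmul_sum_right: "z \<odot> sum f A = (\<Sum>a\<in>A. z \<odot> f a)"
  by (induction A rule: infinite_finite_induct) (auto simp: tmul_add_right tmul_zero)

lemma word_assoc:
  assumes "length a = length b" "length b = length c"
  shows "word_mul (word_mul a b) c = word_mul a (word_mul b c)"
    and "word_sign a b * word_sign (word_mul a b) c = word_sign b c * word_sign a (word_mul b c)"
proof -
  have q: "snd (qmul (snd (qmul x y)) z) = snd (qmul x (snd (qmul y z)))"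
    "fst (qmul x y) * fst (qmul (snd (qmul x y)) z)
       = fst (qmul y z) * fst (qmul x (snd (qmul y z)))" for x y z
    by (cases x; cases y; cases z; simp)+
  show "word_mul (word_mul a b) c = word_mul a (word_mul b c)"
    using assms by (induction a b c rule: list_induct3) (auto simp: word_mul_def q)
  show "word_sign a b * word_sign (word_mul a b) c = word_sign b c * word_sign a (word_mul b c)"
    using assms
  proof (induction a b c rule: list_induct3)
    case (Cons x a y b z c)
    have "word_sign (x # a) (y # b) * word_sign (word_mul (x # a) (y # b)) (z # c)
        = (fst (qmul x y) * fst (qmul (snd (qmul x y)) z))
          * (word_sign a b * word_sign (word_mul a b) c)"
      by (simp add: word_sign_def word_mul_def)
    also have "\<dots> = word_sign (y # b) (z # c) * word_sign (x # a) (word_mul (y # b) (z # c))"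
      unfolding Cons.IH q(2) by (simp add: word_sign_def word_mul_def)
    finally show ?case .
  qed (auto simp: word_sign_def)
qed

lemma quat_tensor_expand:
  "x = (\<Sum>a\<in>Poly_Mapping.keys x. Poly_Mapping.single a (Poly_Mapping.lookup x a))"
  by (rule poly_mapping_eqI)
    (auto simp: lookup_sum lookup_single when_def sum.delta in_keys_iff)

lemma tmul_assoc:
  assumes "x \<in> quat_tensor n" "y \<in> quat_tensor n" "z \<in> quat_tensor n"
  shows "(x \<odot> y) \<odot> z = x \<odot> (y \<odot> z)"
proof -
  let ?s = "\<lambda>x a. Poly_Mapping.single a (Poly_Mapping.lookup x a)"
  have "(?s x a \<odot> ?s y b) \<odot> ?s z c = ?s x a \<odot> (?s y b \<odot> ?s z c)"
    if "a \<in> Poly_Mapping.keys x" "b \<in> Poly_Mapping.keys y" "c \<in> Poly_Mapping.keys z" for a b c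
  proof -
    have "length a = length b" "length b = length c"
      using that assms by (auto simp: quat_tensor_def Delta_def)
    note w = word_assoc[OF this]
    have "word_sign (word_mul a b) c
          * (word_sign a b * Poly_Mapping.lookup x a * Poly_Mapping.lookup y b)
          * Poly_Mapping.lookup z c
        = word_sign a (word_mul b c) * Poly_Mapping.lookup x a
          * (word_sign b c * Poly_Mapping.lookup y b * Poly_Mapping.lookup z c)"
      using w(2) by algebra
    then show ?thesis
      by (simp only: tmul_single w(1))
  qed
  then have "((\<Sum>a\<in>Poly_Mapping.keys x. ?s x a) \<odot> (\<Sum>b\<in>Poly_Mapping.keys y. ?s y b))
        \<odot> (\<Sum>c\<in>Poly_Mapping.keys z. ?s z c)
      = (\<Sum>a\<in>Poly_Mapping.keys x. ?s x a)
        \<odot> ((\<Sum>b\<in>Poly_Mapping.keys y. ?s y b) \<odot> (\<Sum>c\<in>Poly_Mapping.keys z. ?s z c))"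
    by (simp add: tmul_sum_left tmul_sum_right)
  then show ?thesis
    unfolding quat_tensor_expand[symmetric] .
qed

lemma tmul_closed:
  assumes "x \<in> quat_tensor n" "y \<in> quat_tensor n"
  shows "x \<odot> y \<in> quat_tensor n"
proof -
  have sum_closed: "sum f A \<in> quat_tensor n" if "\<And>a. a \<in> A \<Longrightarrow> f a \<in> quat_tensor n"
    for f :: "qword \<Rightarrow> qtensor" and A
    using that
  proof (induction A rule: infinite_finite_induct)
    case (insert a A)
    then show ?case
      using Poly_Mapping.keys_add[of "f a" "sum f A"] by (auto simp: quat_tensor_def)
  qed (auto simp: quat_tensor_def)
  show ?thesis
    unfolding tmul_def
  proof (intro sum_closed)
    fix a b assume "a \<in> Poly_Mapping.keys x" "b \<in> Poly_Mapping.keys y"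
    then have "length a = n" "length b = n"
      using assms by (auto simp: quat_tensor_def Delta_def)
    then show "Poly_Mapping.single (word_mul a b)
        (word_sign a b * Poly_Mapping.lookup x a * Poly_Mapping.lookup y b) \<in> quat_tensor n"
      by (simp add: quat_tensor_def Delta_def word_mul_def)
  qed
qed

lemma tmul_unit:
  assumes "x \<in> quat_tensor n"
  shows "basis_word (e_word n) \<odot> x = x" "x \<odot> basis_word (e_word n) = x"
proof -
  have q: "qmul x QE = (1, x)" for x by (cases x) auto
  have w: "word_mul (e_word (length a)) a = a" "word_mul a (e_word (length a)) = a"
    "word_sign (e_word (length a)) a = 1" "word_sign a (e_word (length a)) = 1" for a
    by (induction a) (auto simp: word_mul_def word_sign_def q)
  have l: "length a = n" if "a \<in> Poly_Mapping.keys x" for a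
    using that assms by (auto simp: quat_tensor_def Delta_def)
  have "basis_word (e_word n) \<odot> x
      = (\<Sum>a\<in>Poly_Mapping.keys x. Poly_Mapping.single a (Poly_Mapping.lookup x a))"
    unfolding tmul_def by (auto intro!: sum.cong simp: w dest!: l)
  then show "basis_word (e_word n) \<odot> x = x" by (simp flip: quat_tensor_expand)
  have "x \<odot> basis_word (e_word n)
      = (\<Sum>a\<in>Poly_Mapping.keys x. Poly_Mapping.single a (Poly_Mapping.lookup x a))"
    unfolding tmul_def by (auto intro!: sum.cong simp: w dest!: l)
  then show "x \<odot> basis_word (e_word n) = x" by (simp flip: quat_tensor_expand)
qed

definition unit_deg :: "real \<Rightarrow> real^2" where
  "unit_deg t = vector [cos (t * pi / 180), sin (t * pi / 180)]"

fun sym_vec :: "qsym \<Rightarrow> real^2" where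
  "sym_vec QI = unit_deg 210"
| "sym_vec QJ = unit_deg 90"
| "sym_vec QK = unit_deg 330"
| "sym_vec QE = 0"

text \<open>
  List positions start at \<open>0\<close>, so that the letter at position \<open>r\<close> carries the
  weight \<open>d\<^sub>1 / 2 ^ r\<close>.
\<close>

definition sigma_sign :: "nat \<Rightarrow> qword \<Rightarrow> real" where
  "sigma_sign r b = (-1) ^ card {s. s < r \<and> b ! s = QE}"

definition centroid :: "real \<Rightarrow> qword \<Rightarrow> real^2" where
  "centroid d1 b = (\<Sum>r<length b. (sigma_sign r b * (d1 / 2 ^ r)) *\<^sub>R sym_vec (b ! r))"

definition nondeg_equilateral :: "real^2 \<Rightarrow> real^2 \<Rightarrow> real^2 \<Rightarrow> bool" where
  "nondeg_equilateral p q r \<longleftrightarrow>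
     dist p q = dist q r \<and> dist q r = dist r p \<and> \<not> collinear {p, q, r}"

definition E_set :: "real \<Rightarrow> nat \<Rightarrow> qword set set" where
  "E_set d1 n = {{b1, b2, b3} | b1 b2 b3.
     b1 \<in> Delta n \<and> b2 \<in> Delta n \<and> b3 \<in> Delta n \<and> b1 \<noteq> b2 \<and> b1 \<noteq> b3 \<and> b2 \<noteq> b3 \<and>
     nondeg_equilateral (centroid d1 b1) (centroid d1 b2) (centroid d1 b3)}"

definition AC_set :: "real \<Rightarrow> nat \<Rightarrow> qword set set" where
  "AC_set d1 n = {{b1, b2, b3} | b1 b2 b3.
     {b1, b2, b3} \<in> E_set d1 n \<and>
     b1 \<noteq> b2 \<and> b1 \<noteq> b3 \<and> b2 \<noteq> b3 \<and>
     anticommute b1 b2 \<and> anticommute b1 b3 \<and> anticommute b2 b3}"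

end

theory Submission
  imports Defs "HOL-Number_Theory.Cong"
begin

text \<open>
  Squaring \<open>b\<^sub>1 + b\<^sub>2 + b\<^sub>3\<close> gives \<open>\<Sum> (-1)\<^bsup>\<nu>(b\<^sub>i)\<^esup> e\<^sub>n\<close> plus one term
  \<open>s\<^bsub>ij\<^esub> w\<^bsub>ij\<^esub>\<close> for each pair \<open>i < j\<close>: up to sign the product of two words does not depend on
  their order, so \<open>b\<^sub>i b\<^sub>j\<close> and \<open>b\<^sub>j b\<^sub>i\<close> are multiples of one word \<open>w\<^bsub>ij\<^esub>\<close>, and the sum
  \<open>s\<^bsub>ij\<^esub>\<close> of their signs vanishes exactly when \<open>b\<^sub>i\<close> and \<open>b\<^sub>j\<close> anticommute. Unsigned words
  form the elementary abelian group \<open>(\<int>/2)\<^bsup>2n\<^esup>\<close>. Cancellation in it keeps \<open>e\<^sub>n\<close> and the three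
  \<open>w\<^bsub>ij\<^esub>\<close> apart, so nothing can cancel between different pairs: the square is a multiple of
  \<open>e\<^sub>n\<close> if and only if all three \<open>s\<^bsub>ij\<^esub>\<close> vanish (\<open>Theta_square_scalar_iff\<close>).

  The common sign is an invariant modulo 3. After scaling by \<open>2\<^sup>n / d\<^sub>1\<close>, the centroid of a word
  lies in the triangular lattice spanned by \<open>v(j)\<close> and \<open>v(i)\<close>, a copy of the Eisenstein integers
  \<open>\<int>[\<omega>]\<close>. Reduction modulo the prime \<open>1 - \<omega>\<close>, with residue field of three elements, sends
  \<open>v(i)\<close>, \<open>v(j)\<close>, \<open>v(k)\<close> all to \<open>1\<close> and \<open>2\<close> to \<open>-1\<close>. The signs \<open>\<sigma>\<^sub>r\<close> then make the
  non-identity letters contribute \<open>+1\<close> and \<open>-1\<close> alternately, and the total tells only whether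
  \<open>\<nu>(b)\<close> is odd (\<open>centroid_lattice\<close>). Squared lengths are values of the norm form
  \<open>a\<^sup>2 - a b + b\<^sup>2 \<equiv> (a + b)\<^sup>2\<close> modulo 3, so the distance between two centroids detects whether
  the parities of \<open>\<nu>\<close> agree (\<open>dist_centroid_mod_3\<close>). Of three words two have equal parity, and
  if all three distances are equal then so are all three parities.
\<close>

section \<open>Products of words\<close>

lemma word_mul_commute: "word_mul a b = word_mul b a"
proof -
  have "snd (qmul x y) = snd (qmul y x)" for x y
    by (cases x; cases y) auto
  then show ?thesis
    unfolding word_mul_def by (subst zip_commute) (simp add: case_prod_beta)
qed

lemma word_mul_self: "word_mul a a = e_word (length a)"
proof -
  have "snd (qmul x x) = QE" for x by (cases x) auto
  then show ?thesis by (induction a) (auto simp: word_mul_def)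
qed

lemma word_mul_left_cancel:
  assumes "word_mul a b = word_mul a c" "length a = length b" "length b = length c"
  shows "b = c"
proof -
  have q: "snd (qmul x y) = snd (qmul x z) \<longleftrightarrow> y = z" for x y z
    by (cases x; cases y; cases z) auto
  show ?thesis
    using assms(2,3,1) by (induction a b c rule: list_induct3) (auto simp: word_mul_def q)
qed

lemma nu_filter: "nu b = length (filter (\<lambda>x. x \<noteq> QE) b)"
  by (simp add: nu_def length_filter_conv_card)

lemma nu_Nil: "nu [] = 0"
  by (simp add: nu_filter)

lemma nu_Cons: "nu (x # b) = (if x = QE then nu b else Suc (nu b))"
  by (simp add: nu_filter)

lemma word_sign_self: "word_sign a a = (-1) ^ nu a"
proof (induction a)
  case (Cons x a)
  then show ?case by (cases x) (auto simp: word_sign_def nu_Cons)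
qed (simp add: word_sign_def nu_Nil)

lemma anticommute_iff: "anticommute a b \<longleftrightarrow> word_sign a b + word_sign b a = 0"
proof -
  have "anticommute a b \<longleftrightarrow> Poly_Mapping.single (word_mul a b) (word_sign a b)
      = Poly_Mapping.single (word_mul a b) (- word_sign b a)"
    by (simp add: anticommute_def tmul_single word_mul_commute[of b a] flip: single_uminus)
  also have "\<dots> \<longleftrightarrow> word_sign a b + word_sign b a = 0"
    by (metis add_eq_0_iff2 lookup_single_eq)
  finally show ?thesis .
qed

lemma anticommute_sym: "anticommute a b \<Longrightarrow> anticommute b a"
  by (simp add: anticommute_iff add.commute)

section \<open>The square of a sum of three words\<close>

lemma Theta_square:
  assumes "b1 \<in> Delta n" "b2 \<in> Delta n" "b3 \<in> Delta n"
    and "b1 \<noteq> b2" "b1 \<noteq> b3" "b2 \<noteq> b3"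
  shows "Theta {b1, b2, b3} \<odot> Theta {b1, b2, b3}
    = Poly_Mapping.single (e_word n) ((-1) ^ nu b1 + (-1) ^ nu b2 + (-1) ^ nu b3)
      + Poly_Mapping.single (word_mul b1 b2) (word_sign b1 b2 + word_sign b2 b1)
      + Poly_Mapping.single (word_mul b1 b3) (word_sign b1 b3 + word_sign b3 b1)
      + Poly_Mapping.single (word_mul b2 b3) (word_sign b2 b3 + word_sign b3 b2)"
proof -
  have "length b1 = n" "length b2 = n" "length b3 = n"
    using assms by (auto simp: Delta_def)
  then show ?thesis
    using assms(4-6)
    by (simp add: Theta_def tmul_add_left tmul_add_right tmul_single word_mul_self word_sign_self
        word_mul_commute[of b2 b1] word_mul_commute[of b3 b1] word_mul_commute[of b3 b2]
        single_add ac_simps)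
qed

text \<open>
  Only pairs with nonzero \<open>s\<^bsub>ij\<^esub>\<close> can leave the line of \<open>e\<^sub>n\<close>, and no two pairs give the same
  word: a common factor of \<open>w\<^bsub>ij\<^esub> = w\<^bsub>ik\<^esub>\<close> cancels. For more than three words this fails, as
  \<open>b\<^sub>1 b\<^sub>2\<close> and \<open>b\<^sub>3 b\<^sub>4\<close> may be opposite.
\<close>

lemma Theta_square_scalar_iff:
  assumes "b1 \<in> Delta n" "b2 \<in> Delta n" "b3 \<in> Delta n"
    and "b1 \<noteq> b2" "b1 \<noteq> b3" "b2 \<noteq> b3"
  shows "(\<exists>c. Theta {b1, b2, b3} \<odot> Theta {b1, b2, b3} = Poly_Mapping.single (e_word n) c)
    \<longleftrightarrow> anticommute b1 b2 \<and> anticommute b1 b3 \<and> anticommute b2 b3"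
    (is "(\<exists>c. ?S = _ c) \<longleftrightarrow> ?A")
proof
  have len: "length b1 = n" "length b2 = n" "length b3 = n"
    using assms by (auto simp: Delta_def)
  have cancel: "word_mul a b \<noteq> word_mul a c"
    if "b \<noteq> c" "length a = n" "length b = n" "length c = n" for a b c
    using that word_mul_left_cancel by metis
  have neq_e: "word_mul a b \<noteq> e_word n" if "a \<noteq> b" "length a = n" "length b = n" for a b
    using cancel[of b a a] that by (simp add: word_mul_self)
  \<comment> \<open>Hence each coefficient of the square can be read off from a single term.\<close>
  have distinct: "distinct [e_word n, word_mul b1 b2, word_mul b1 b3, word_mul b2 b3]"
    using neq_e[of b1 b2] neq_e[of b1 b3] neq_e[of b2 b3] cancel[of b2 b3 b1]
      cancel[of b1 b3 b2] cancel[of b1 b2 b3] assms(4-6) len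
    by (auto simp: word_mul_commute[of b2 b1] word_mul_commute[of b3 b1] word_mul_commute[of b3 b2])
  {
    assume "\<exists>c. ?S = Poly_Mapping.single (e_word n) c"
    then obtain c where c: "?S = Poly_Mapping.single (e_word n) c" by blast
    have "Poly_Mapping.lookup ?S w = 0" if "w \<noteq> e_word n" for w
      using that by (simp add: c lookup_single when_def)
    then have "Poly_Mapping.lookup ?S (word_mul b1 b2) = 0" "Poly_Mapping.lookup ?S (word_mul b1 b3) = 0"
      "Poly_Mapping.lookup ?S (word_mul b2 b3) = 0"
      using distinct by auto
    then show ?A
      using distinct
      by (auto simp: Theta_square[OF assms] lookup_add lookup_single when_def anticommute_iff)
  }
  assume ?A
  then show "\<exists>c. ?S = Poly_Mapping.single (e_word n) c"
    by (auto simp: Theta_square[OF assms] anticommute_iff)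
qed

section \<open>Centroids in the triangular lattice\<close>

lemma sym_vec_coordinates:
  "sym_vec QI $ 1 = - sqrt 3 / 2" "sym_vec QI $ 2 = - 1 / 2"
  "sym_vec QJ $ 1 = 0" "sym_vec QJ $ 2 = 1"
  "sym_vec QK $ 1 = sqrt 3 / 2" "sym_vec QK $ 2 = - 1 / 2"
proof -
  have angles: "210 * pi / 180 = pi / 6 + pi" "90 * pi / 180 = pi / 2"
    "330 * pi / 180 = 2 * pi - pi / 6"
    by simp_all
  show "sym_vec QI $ 1 = - sqrt 3 / 2" "sym_vec QI $ 2 = - 1 / 2"
    "sym_vec QJ $ 1 = 0" "sym_vec QJ $ 2 = 1"
    "sym_vec QK $ 1 = sqrt 3 / 2" "sym_vec QK $ 2 = - 1 / 2"
    unfolding sym_vec.simps unit_deg_def angles vector_2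
      cos_periodic_pi sin_periodic_pi cos_diff sin_diff cos_30 sin_30
    by simp_all
qed

lemma sym_vec_QK: "sym_vec QK = - sym_vec QJ - sym_vec QI"
  by (simp only: vec_eq_iff forall_2 vector_minus_component vector_uminus_component
      sym_vec_coordinates) simp

text \<open>The norm form of the Eisenstein integers: \<open>v(j)\<close> and \<open>v(i)\<close> enclose an angle of \<open>120\<close> degrees.\<close>

lemma norm_lattice_vector:
  "(norm (a *\<^sub>R sym_vec QJ + b *\<^sub>R sym_vec QI))\<^sup>2 = a\<^sup>2 - a * b + b\<^sup>2"
proof -
  have "(norm (a *\<^sub>R sym_vec QJ + b *\<^sub>R sym_vec QI))\<^sup>2
      = (b * (- sqrt 3 / 2))\<^sup>2 + (a + b * (- 1 / 2))\<^sup>2"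
    by (simp only: power2_norm_eq_inner inner_vec_def sum_2 vector_add_component
        vector_scaleR_component sym_vec_coordinates inner_real_def) (simp add: power2_eq_square)
  also have "\<dots> = a\<^sup>2 - a * b + b\<^sup>2"
    by (simp add: power2_eq_square algebra_simps)
  finally show ?thesis .
qed

lemma sigma_sign_Suc:
  "sigma_sign (Suc r) (x # b) = (if x = QE then - 1 else 1) * sigma_sign r b"
proof -
  let ?A = "{s. s < r \<and> b ! s = QE}"
  have "{s. s < Suc r \<and> (x # b) ! s = QE} = (if x = QE then insert 0 (Suc ` ?A) else Suc ` ?A)"
    by (auto simp: less_Suc_eq_0_disj)
  then show ?thesis
    by (simp add: sigma_sign_def card_image)
qed

lemma centroid_Nil: "centroid d [] = 0"
  by (simp add: centroid_def)

lemma centroid_Cons: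
  "centroid d (x # b) = d *\<^sub>R sym_vec x + (if x = QE then - 1 else 1) *\<^sub>R centroid (d / 2) b"
proof -
  have "sigma_sign 0 (x # b) = 1" by (simp add: sigma_sign_def)
  then show ?thesis
    by (simp add: centroid_def sum.lessThan_Suc_shift sigma_sign_Suc scaleR_sum_right
        field_simps del: sum.lessThan_Suc)
qed

text \<open>
  The residue \<open>p + q\<close> modulo 3 is the reduction modulo \<open>1 - \<omega>\<close>. Prepending the identity letter
  negates it, which is absorbed by the change of length; prepending another letter adds
  \<open>2\<^bsup>n+1\<^esup> \<equiv> (-1)\<^bsup>n+1\<^esup>\<close>, which toggles between \<open>0\<close> and a sign that depends on the length only.
\<close>

lemma centroid_lattice:
  "\<exists>p q :: int. (\<forall>d. centroid d b
       = (d / 2 ^ length b) *\<^sub>R (of_int p *\<^sub>R sym_vec QJ + of_int q *\<^sub>R sym_vec QI))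
     \<and> [p + q = (-1) ^ length b * of_bool (odd (nu b))] (mod 3)"
proof (induction b)
  case Nil
  show ?case by (rule exI[of _ 0], rule exI[of _ 0]) (simp add: centroid_Nil nu_Nil)
next
  case (Cons x b)
  let ?lat = "\<lambda>p q :: int. of_int p *\<^sub>R sym_vec QJ + of_int q *\<^sub>R sym_vec QI"
  let ?n = "length b"
  obtain p q :: int where
    c: "\<And>d. centroid d b = (d / 2 ^ ?n) *\<^sub>R ?lat p q"
    and m: "[p + q = (-1) ^ ?n * of_bool (odd (nu b))] (mod 3)"
    using Cons.IH by blast
  define s :: int where "s = (if x = QE then - 1 else 1)"
  \<comment> \<open>Modulo 3 the residue \<open>-2\<close> of \<open>v(k) = - v(j) - v(i)\<close> is the residue \<open>1\<close> of \<open>v(i)\<close> and \<open>v(j)\<close>.\<close>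
  obtain f g :: int where fg: "sym_vec x = ?lat f g" "[f + g = of_bool (x \<noteq> QE)] (mod 3)"
  proof (cases x)
    case QI then show ?thesis using that[of 0 1] by simp
  next
    case QJ then show ?thesis using that[of 1 0] by simp
  next
    case QK then show ?thesis
      using that[of "-1" "-1"] sym_vec_QK by (simp add: cong_def del: sym_vec.simps)
  next
    case QE then show ?thesis using that[of 0 0] by simp
  qed
  have "centroid d (x # b)
      = (d / 2 ^ length (x # b)) *\<^sub>R ?lat (2 ^ Suc ?n * f + s * p) (2 ^ Suc ?n * g + s * q)" for d
  proof -
    have "centroid d (x # b) = d *\<^sub>R ?lat f g + of_int s *\<^sub>R (d / 2 ^ Suc ?n) *\<^sub>R ?lat p q"
      by (simp add: centroid_Cons c s_def fg(1)[symmetric] del: sym_vec.simps)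
    also have "d *\<^sub>R ?lat f g = (d / 2 ^ Suc ?n) *\<^sub>R (2 ^ Suc ?n) *\<^sub>R ?lat f g"
      by simp
    finally show ?thesis
      by (simp add: algebra_simps del: sym_vec.simps)
  qed
  moreover have "[(2 ^ Suc ?n * f + s * p) + (2 ^ Suc ?n * g + s * q)
      = (-1) ^ length (x # b) * of_bool (odd (nu (x # b)))] (mod 3)"
  proof -
    have two: "[2 ^ Suc ?n = (-1) ^ Suc ?n] (mod (3::int))"
      by (intro cong_pow) (simp add: cong_def)
    have "[2 ^ Suc ?n * (f + g) + s * (p + q)
        = (-1) ^ Suc ?n * of_bool (x \<noteq> QE) + s * ((-1) ^ ?n * of_bool (odd (nu b)))] (mod 3)"
      by (intro cong_add cong_mult two fg(2) m cong_refl)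
    also have "(-1) ^ Suc ?n * of_bool (x \<noteq> QE) + s * ((-1) ^ ?n * of_bool (odd (nu b)))
        = (-1) ^ length (x # b) * of_bool (odd (nu (x # b)))"
      by (auto simp: s_def nu_Cons)
    finally show ?thesis by (simp add: algebra_simps)
  qed
  ultimately show ?case by blast
qed

section \<open>Equilateral triangles have constant parity\<close>

text \<open>
  The norm form is congruent to \<open>(a + b)\<^sup>2\<close> modulo 3, and a square modulo 3 tells precisely whether
  its root vanishes.
\<close>

lemma dist_centroid_mod_3:
  assumes "length b = n" "length c = n"
  shows "\<exists>m :: int. (dist (centroid d b) (centroid d c))\<^sup>2 = (d / 2 ^ n)\<^sup>2 * of_int m
           \<and> (3 dvd m \<longleftrightarrow> even (nu b) = even (nu c))"
proof -
  let ?lat = "\<lambda>p q :: int. of_int p *\<^sub>R sym_vec QJ + of_int q *\<^sub>R sym_vec QI"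
  obtain p q where b: "centroid d b = (d / 2 ^ n) *\<^sub>R ?lat p q"
    and pq: "[p + q = (-1) ^ n * of_bool (odd (nu b))] (mod 3)"
    using centroid_lattice[of b] assms by auto
  obtain r s where c: "centroid d c = (d / 2 ^ n) *\<^sub>R ?lat r s"
    and rs: "[r + s = (-1) ^ n * of_bool (odd (nu c))] (mod 3)"
    using centroid_lattice[of c] assms by auto
  define f g where "f = p - r" and "g = q - s"
  define m where "m = f\<^sup>2 - f * g + g\<^sup>2"
  have "centroid d b - centroid d c = (d / 2 ^ n) *\<^sub>R ?lat f g"
    by (simp add: b c f_def g_def algebra_simps del: sym_vec.simps)
  then have "(dist (centroid d b) (centroid d c))\<^sup>2 = (d / 2 ^ n)\<^sup>2 * (norm (?lat f g))\<^sup>2"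
    by (simp add: dist_norm power_mult_distrib power_divide del: sym_vec.simps)
  then have dist: "(dist (centroid d b) (centroid d c))\<^sup>2 = (d / 2 ^ n)\<^sup>2 * of_int m"
    by (simp add: norm_lattice_vector m_def del: sym_vec.simps)
  have "m = (f + g)\<^sup>2 - 3 * (f * g)"
    by (simp add: m_def power2_eq_square algebra_simps)
  then have "3 dvd m \<longleftrightarrow> 3 dvd (f + g)\<^sup>2"
    by (simp add: dvd_diff_left_iff)
  also have "\<dots> \<longleftrightarrow> 3 dvd f + g"
    by (rule prime_dvd_power_iff) simp_all
  also have "\<dots> \<longleftrightarrow> [p + q = r + s] (mod 3)"
    by (simp add: cong_iff_dvd_diff f_def g_def algebra_simps)
  also have "\<dots> \<longleftrightarrow> [(-1) ^ n * of_bool (odd (nu b)) = (-1) ^ n * of_bool (odd (nu c))] (mod (3::int))"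
    using pq rs by (meson cong_sym cong_trans)
  also have "\<dots> \<longleftrightarrow> even (nu b) = even (nu c)"
    by (cases "even n") (auto simp: cong_def)
  finally show ?thesis using dist by blast
qed

text \<open>
  The positive factor \<open>(d / 2\<^sup>n)\<^sup>2\<close> cancels, so equal distances give equal integers: either all
  pairs of words have equal parity or no pair does, and the latter is impossible with two parities.
\<close>

lemma nondeg_equilateral_even_nu:
  assumes "length b1 = n" "length b2 = n" "length b3 = n" and "d > 0"
    and "nondeg_equilateral (centroid d b1) (centroid d b2) (centroid d b3)"
  shows "even (nu b1) = even (nu b2)" "even (nu b2) = even (nu b3)"
proof -
  obtain m12 m23 m31 :: int where
    m: "(dist (centroid d b1) (centroid d b2))\<^sup>2 = (d / 2 ^ n)\<^sup>2 * of_int m12"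
      "(dist (centroid d b2) (centroid d b3))\<^sup>2 = (d / 2 ^ n)\<^sup>2 * of_int m23"
      "(dist (centroid d b3) (centroid d b1))\<^sup>2 = (d / 2 ^ n)\<^sup>2 * of_int m31"
    and iff: "3 dvd m12 \<longleftrightarrow> even (nu b1) = even (nu b2)"
      "3 dvd m23 \<longleftrightarrow> even (nu b2) = even (nu b3)"
      "3 dvd m31 \<longleftrightarrow> even (nu b3) = even (nu b1)"
    using dist_centroid_mod_3 assms(1-3) by metis
  have "m12 = m23" "m23 = m31"
    using assms(4,5) m unfolding nondeg_equilateral_def by auto
  then show "even (nu b1) = even (nu b2)" "even (nu b2) = even (nu b3)"
    using iff by auto
qed

lemma E_set_even_nu:
  assumes "T \<in> E_set d n" "d > 0" "b \<in> T" "c \<in> T"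
  shows "even (nu b) = even (nu c)"
proof -
  obtain c1 c2 c3 where T: "T = {c1, c2, c3}"
    and len: "length c1 = n" "length c2 = n" "length c3 = n"
    and eq: "nondeg_equilateral (centroid d c1) (centroid d c2) (centroid d c3)"
    using assms(1) by (auto simp: E_set_def Delta_def)
  show ?thesis
    using nondeg_equilateral_even_nu[OF len assms(2) eq] assms(3,4) T by auto
qed

text \<open>
  Membership in \<open>AC_set\<close> gives anticommutation for some enumeration of the set; by symmetry of
  the relation it holds for every enumeration.
\<close>

lemma AC_set_iff:
  assumes "b1 \<noteq> b2" "b1 \<noteq> b3" "b2 \<noteq> b3"
  shows "{b1, b2, b3} \<in> AC_set d n \<longleftrightarrow> {b1, b2, b3} \<in> E_set d n
    \<and> anticommute b1 b2 \<and> anticommute b1 b3 \<and> anticommute b2 b3"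
proof
  assume "{b1, b2, b3} \<in> AC_set d n"
  then obtain c1 c2 c3 where T: "{b1, b2, b3} = {c1, c2, c3}" "{c1, c2, c3} \<in> E_set d n"
    and ac: "anticommute c1 c2" "anticommute c1 c3" "anticommute c2 c3"
    unfolding AC_set_def by blast
  have "anticommute x y" if "x \<in> {c1, c2, c3}" "y \<in> {c1, c2, c3}" "x \<noteq> y" for x y
    using that ac anticommute_sym by auto
  then show "{b1, b2, b3} \<in> E_set d n
      \<and> anticommute b1 b2 \<and> anticommute b1 b3 \<and> anticommute b2 b3"
    using T assms by (metis insert_iff)
next
  assume "{b1, b2, b3} \<in> E_set d n
    \<and> anticommute b1 b2 \<and> anticommute b1 b3 \<and> anticommute b2 b3"
  then show "{b1, b2, b3} \<in> AC_set d n"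
    using assms unfolding AC_set_def by blast
qed

theorem proposition10p4:
  fixes n :: nat and d1 :: real and b1 b2 b3 :: qword
  assumes "n \<ge> 1" and "d1 > 0"
    and "b1 \<in> Delta n" and "b2 \<in> Delta n" and "b3 \<in> Delta n"
    and "b1 \<noteq> b2" and "b1 \<noteq> b3" and "b2 \<noteq> b3"
  shows "((\<exists>c::real. Theta {b1, b2, b3} \<odot> Theta {b1, b2, b3} = Poly_Mapping.single (e_word n) c)
           \<longleftrightarrow> anticommute b1 b2 \<and> anticommute b1 b3 \<and> anticommute b2 b3)
       \<and> ({b1, b2, b3} \<in> E_set d1 n \<longrightarrow>
           (\<exists>\<epsilon>::real. \<epsilon> = (-1) ^ nu b1 \<and> \<epsilon> = (-1) ^ nu b2 \<and> \<epsilon> = (-1) ^ nu b3 \<and>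
              ({b1, b2, b3} \<in> AC_set d1 n
                \<longleftrightarrow> Theta {b1, b2, b3} \<odot> Theta {b1, b2, b3}
                     = Poly_Mapping.single (e_word n) (3 * \<epsilon>))))"
proof (intro conjI impI)
  note words = assms(3-8)
  show scalar: "(\<exists>c. Theta {b1, b2, b3} \<odot> Theta {b1, b2, b3} = Poly_Mapping.single (e_word n) c)
      \<longleftrightarrow> anticommute b1 b2 \<and> anticommute b1 b3 \<and> anticommute b2 b3"
    by (rule Theta_square_scalar_iff[OF words])
  assume E: "{b1, b2, b3} \<in> E_set d1 n"
  define \<epsilon> :: real where "\<epsilon> = (-1) ^ nu b1"
  have "even (nu b2) = even (nu b1)" "even (nu b3) = even (nu b1)"
    using E_set_even_nu[OF E \<open>d1 > 0\<close>] by auto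
  then have eps: "\<epsilon> = (-1) ^ nu b1" "\<epsilon> = (-1) ^ nu b2" "\<epsilon> = (-1) ^ nu b3"
    by (simp_all add: \<epsilon>_def minus_one_power_iff)
  have "{b1, b2, b3} \<in> AC_set d1 n \<longleftrightarrow>
      Theta {b1, b2, b3} \<odot> Theta {b1, b2, b3} = Poly_Mapping.single (e_word n) (3 * \<epsilon>)"
  proof
    assume "{b1, b2, b3} \<in> AC_set d1 n"
    then have "anticommute b1 b2" "anticommute b1 b3" "anticommute b2 b3"
      using AC_set_iff words(4-6) by auto
    then show "Theta {b1, b2, b3} \<odot> Theta {b1, b2, b3} = Poly_Mapping.single (e_word n) (3 * \<epsilon>)"
      by (simp add: Theta_square[OF words] anticommute_iff flip: eps)
  next
    assume "Theta {b1, b2, b3} \<odot> Theta {b1, b2, b3} = Poly_Mapping.single (e_word n) (3 * \<epsilon>)"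
    then show "{b1, b2, b3} \<in> AC_set d1 n"
      using scalar E AC_set_iff words(4-6) by blast
  qed
  then show "\<exists>\<epsilon>::real. \<epsilon> = (-1) ^ nu b1 \<and> \<epsilon> = (-1) ^ nu b2 \<and> \<epsilon> = (-1) ^ nu b3 \<and>
      ({b1, b2, b3} \<in> AC_set d1 n
        \<longleftrightarrow> Theta {b1, b2, b3} \<odot> Theta {b1, b2, b3} = Poly_Mapping.single (e_word n) (3 * \<epsilon>))"
    using eps by blast
qed

end
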